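(* Let $p$ and $r$ be two probability distributions on the same discretized asset grid $\{0,\ldots,m-1\}^d$, and let $B$ be the basket map on this grid. If the pushforward distributions on $\mathbb{R}$ agree, $$B_{\#}p=B_{\#}r,$$ then for every measurable function $h:\mathbb{R}\to\mathbb{R}$, $$\mathbb{E}_{\boldsymbol{x}\sim p}[h(B(\boldsymbol{x}))]=\mathbb{E}_{\boldsymbol{x}\sim r}[h(B(\boldsymbol{x}))].$$ In particular, the basket-call prices under $p$ and under $r$ are equal for all strikes $K$, i.e. $e^{-r_f T}\,\mathbb{E}_{\boldsymbol{x}\sim p}[(B(\boldsymbol{x})-K)^+]=e^{-r_f T}\,\mathbb{E}_{\boldsymbol{x}\sim r}[(B(\boldsymbol{x})-K)^+]$ for all $K\in\mathbb{R}$.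
   Context: There are $d$ assets, each discretized on a local grid of size $m=2^q$; a grid configuration is $\boldsymbol{x}=(x_1,\ldots,x_d)$ with $x_i\in\{0,\ldots,m-1\}$. For each asset $i$, $S_i:\{0,\ldots,m-1\}\to\mathbb{R}$ gives the terminal value $S_i(x_i)$ at local grid point $x_i$, and $w_1,\ldots,w_d$ are real basket weights with $\sum_{i=1}^d w_i=1$. The basket map is $$B(\boldsymbol{x})=\sum_{i=1}^d w_i S_i(x_i).$$ For a probability distribution $p$ on the grid, $B_{\#}p$ is the pushforward distribution on $\mathbb{R}$: $(B_{\#}p)(A)=p(\{\boldsymbol{x}:B(\boldsymbol{x})\in A\})$ for Borel $A\subset\mathbb{R}$. Here $(y)^+=\max(y,0)$, $r_f$ denotes the (constant) risk-free rate and $T$ the maturity; the basket-call price with strike $K$ under $p$ is $e^{-r_f T}\,\mathbb{E}_{\boldsymbol{x}\sim p}[(B(\boldsymbol{x})-K)^+]$. *)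

theory Defs
  imports "HOL-Probability.Probability"
begin

text \<open>
  A grid point is a function on the asset indices \<open>1, \<dots>, d\<close> that is \<open>undefined\<close> elsewhere, so that
  points correspond exactly to the \<open>d\<close>-tuples with entries in \<open>{0..<m}\<close>.  A probability
  distribution on the grid is a \<open>pmf\<close> supported in it.  The grid is finite, so every real function is
  integrable with respect to such a distribution and no expectation below takes the default value
  0 of a non-integrable function.
\<close>

definition grid :: "nat \<Rightarrow> nat \<Rightarrow> (nat \<Rightarrow> nat) set" where
  "grid d m = (\<Pi>\<^sub>E i\<in>{1..d}. {0..<m})"

definition basket :: "nat \<Rightarrow> (nat \<Rightarrow> real) \<Rightarrow> (nat \<Rightarrow> nat \<Rightarrow> real) \<Rightarrow> (nat \<Rightarrow> nat) \<Rightarrow> real" where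
  "basket d w S x = (\<Sum>i=1..d. w i * S i (x i))"

text \<open>
  The \<open>\<sigma>\<close>-algebra of \<open>measure_pmf p\<close> contains all sets, so \<open>B\<close> is measurable and the measure of a
  Borel set \<open>A\<close> under \<open>pushforward B p\<close> is the \<open>p\<close>-probability of \<open>{x. B x \<in> A}\<close>.
\<close>

definition pushforward :: "('a \<Rightarrow> real) \<Rightarrow> 'a pmf \<Rightarrow> real measure" where
  "pushforward B p = distr (measure_pmf p) borel B"

definition call_price :: "real \<Rightarrow> real \<Rightarrow> ('a \<Rightarrow> real) \<Rightarrow> 'a pmf \<Rightarrow> real \<Rightarrow> real" where
  "call_price r_f T B p K = exp (- r_f * T) * measure_pmf.expectation p (\<lambda>x. max (B x - K) 0)"

end

theory Submission
  imports Defs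
begin

text \<open>By change of variables, the expectation of \<open>h (B x)\<close> is the integral of
  \<open>h\<close> against the law of \<open>B\<close>, so it depends on the distribution only
  through its pushforward; equal laws give equal expectations.
  \<open>expectation_pushforward\<close> carries this for an arbitrary pmf: \<open>B\<close> is
  measurable because every set is measurable for a pmf, and if \<open>h (B x)\<close> is not
  integrable, both sides take the default value 0.\<close>

lemma expectation_pushforward:
  fixes h :: "real \<Rightarrow> real"
  assumes "h \<in> borel_measurable borel"
  shows "measure_pmf.expectation p (\<lambda>x. h (B x)) = integral\<^sup>L (pushforward B p) h"
  unfolding pushforward_def using assms by (simp add: integral_distr)

theorem proposition2:
  fixes d q m :: nat
    and w :: "nat \<Rightarrow> real"
    and S :: "nat \<Rightarrow> nat \<Rightarrow> real"
    and r_f T :: real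
    and p r :: "(nat \<Rightarrow> nat) pmf"
  assumes "m = 2 ^ q"
    and "(\<Sum>i=1..d. w i) = 1"
    and "set_pmf p \<subseteq> grid d m"
    and "set_pmf r \<subseteq> grid d m"
    and "pushforward (basket d w S) p = pushforward (basket d w S) r"
  shows "(\<forall>h :: real \<Rightarrow> real. h \<in> borel_measurable borel \<longrightarrow>
            measure_pmf.expectation p (\<lambda>x. h (basket d w S x)) =
            measure_pmf.expectation r (\<lambda>x. h (basket d w S x)))
       \<and> (\<forall>K :: real. call_price r_f T (basket d w S) p K = call_price r_f T (basket d w S) r K)"
proof -
  have eq: "measure_pmf.expectation p (\<lambda>x. h (basket d w S x)) =
      measure_pmf.expectation r (\<lambda>x. h (basket d w S x))"
    if "h \<in> borel_measurable borel" for h :: "real \<Rightarrow> real"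
    using assms(5) that by (simp add: expectation_pushforward)
  have "call_price r_f T (basket d w S) p K = call_price r_f T (basket d w S) r K" for K
    \<comment> \<open>The call payoff is a Borel function of the basket value alone, so it is an
      admissible \<open>h\<close>; the discount factor is common to both prices.\<close>
    unfolding call_price_def using eq[of "\<lambda>y. max (y - K) 0"] by simp
  with eq show ?thesis by blast
qed

end
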